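(* Let $m\ge 1$ be an integer, let $F=\{f_i\}_{i=1}^\infty$ be an $m$-erasure robust frame for a Hilbert space $\mathcal{H}$, and let $P$ be an orthogonal projection on $\mathcal{H}$. Then $PF=\{Pf_i\}_{i=1}^\infty$ is an $m$-erasure robust frame for $P\mathcal{H}$.
   Context: A sequence $\{f_i\}_{i\in I}$ in a Hilbert space $\mathcal{K}$ ($I$ countable) is a frame for $\mathcal{K}$ if there are constants $A,B>0$ with $A\|f\|^2\le\sum_{i\in I}|\langle f,f_i\rangle|^2\le B\|f\|^2$ for all $f\in\mathcal{K}$. A frame $\{f_i\}_{i=1}^\infty$ for $\mathcal{K}$ is $m$-erasure robust if for every $\Lambda\subset\mathbb{N}$ with $|\Lambda|=m$ the family $\{f_i\}_{i\in\mathbb{N}\setminus\Lambda}$ is a frame for $\mathcal{K}$. *)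

theory Defs
  imports "HOL-Analysis.Analysis"
begin

text \<open>
  The real and the complex numbers are the only models of this class: by the Gelfand-Mazur theorem
  every \<^class>\<open>real_normed_field\<close> is one of the two, and the last axiom determines the conjugation.
  It serves to treat real and complex Hilbert spaces at once.
\<close>

class rc_field = real_normed_field +
  fixes conj :: "'a \<Rightarrow> 'a"
  assumes conj_add: "conj (a + b) = conj a + conj b"
    and conj_mult: "conj (a * b) = conj a * conj b"
    and conj_conj: "conj (conj a) = a"
    and mult_conj: "a * conj a = (norm a)\<^sup>2 *\<^sub>R 1"

instantiation real :: rc_field
begin

definition conj_real :: "real \<Rightarrow> real"
  where "conj_real a = a"

instance
  by standard (auto simp: conj_real_def power2_eq_square)

end

instantiation complex :: rc_field
begin

definition conj_complex :: "complex \<Rightarrow> complex"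
  where "conj_complex a = cnj a"

instance
  by standard (auto simp: conj_complex_def scaleR_conv_of_real simp flip: complex_norm_square)

end

text \<open>
  Completeness is part of the class \<^class>\<open>banach\<close>. Positive definiteness of the inner product is
  contained in \<open>ip_self\<close>, which also says that the norm of the type is the one induced by \<open>ip\<close>.
\<close>

locale hilbert_space = vector_space smul
  for smul :: "'k::rc_field \<Rightarrow> 'a::banach \<Rightarrow> 'a" +
  fixes ip :: "'a \<Rightarrow> 'a \<Rightarrow> 'k"
  assumes smul_of_real: "smul (of_real r) x = r *\<^sub>R x"
    and ip_add_left: "ip (x + y) z = ip x z + ip y z"
    and ip_smul_left: "ip (smul c x) y = c * ip x y"
    and ip_commute: "ip x y = conj (ip y x)"
    and ip_self: "ip x x = of_real ((norm x)\<^sup>2)"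

lemma hilbert_space_real_inner:
  "hilbert_space scaleR (inner :: 'a::{real_inner, banach} \<Rightarrow> 'a \<Rightarrow> real)"
  by unfold_locales
    (auto simp: algebra_simps conj_real_def inner_commute power2_norm_eq_inner)

lemma hilbert_space_complex:
  "hilbert_space (*) (\<lambda>x y :: complex. x * cnj y)"
  by unfold_locales
    (auto simp: algebra_simps conj_complex_def scaleR_conv_of_real simp flip: complex_norm_square)

text \<open>
  The space \<open>K\<close> is a closed subspace of the ambient Hilbert space, hence a Hilbert space itself.
  Summability is required separately since \<^const>\<open>infsum\<close> is \<open>0\<close> on families that are
  not summable.
\<close>

definition is_frame ::
  "('k::rc_field \<Rightarrow> 'a::banach \<Rightarrow> 'a) \<Rightarrow> ('a \<Rightarrow> 'a \<Rightarrow> 'k) \<Rightarrow> 'a set \<Rightarrow> 'i set \<Rightarrow> ('i \<Rightarrow> 'a) \<Rightarrow> bool"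
  where "is_frame smul ip K I f \<longleftrightarrow>
    module.subspace smul K \<and> closed K \<and> countable I \<and> (\<forall>i\<in>I. f i \<in> K) \<and>
    (\<exists>A B :: real. A > 0 \<and> B > 0 \<and>
      (\<forall>x\<in>K. (\<lambda>i. (norm (ip x (f i)))\<^sup>2) summable_on I \<and>
        A * (norm x)\<^sup>2 \<le> (\<Sum>\<^sub>\<infinity>i\<in>I. (norm (ip x (f i)))\<^sup>2) \<and>
        (\<Sum>\<^sub>\<infinity>i\<in>I. (norm (ip x (f i)))\<^sup>2) \<le> B * (norm x)\<^sup>2))"

text \<open>Sequences are indexed by the positive integers; the value \<open>f 0\<close> is irrelevant.\<close>

definition erasure_robust_frame ::
  "('k::rc_field \<Rightarrow> 'a::banach \<Rightarrow> 'a) \<Rightarrow> ('a \<Rightarrow> 'a \<Rightarrow> 'k) \<Rightarrow> nat \<Rightarrow> 'a set \<Rightarrow> (nat \<Rightarrow> 'a) \<Rightarrow> bool"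
  where "erasure_robust_frame smul ip m K f \<longleftrightarrow>
    is_frame smul ip K {1..} f \<and>
    (\<forall>\<Lambda>. \<Lambda> \<subseteq> {1..} \<and> finite \<Lambda> \<and> card \<Lambda> = m \<longrightarrow> is_frame smul ip K ({1..} - \<Lambda>) f)"

text \<open>
  A linear idempotent self-adjoint operator; boundedness is automatic, as
  \<open>\<parallel>P x\<parallel>\<^sup>2 = ip x (P x) \<le> \<parallel>x\<parallel> * \<parallel>P x\<parallel>\<close>.
\<close>

definition orthogonal_projection ::
  "('k::rc_field \<Rightarrow> 'a::banach \<Rightarrow> 'a) \<Rightarrow> ('a \<Rightarrow> 'a \<Rightarrow> 'k) \<Rightarrow> ('a \<Rightarrow> 'a) \<Rightarrow> bool"
  where "orthogonal_projection smul ip P \<longleftrightarrow>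
    Vector_Spaces.linear smul smul P \<and> (\<forall>x. P (P x) = P x) \<and> (\<forall>x y. ip (P x) y = ip x (P y))"

end

theory Submission
  imports Defs
begin

text \<open>
  For \<open>x\<close> in the range of \<open>P\<close>, self-adjointness gives \<open>ip x (P (f i)) = ip (P x) (f i) = ip x (f i)\<close>.
  So \<open>P F\<close> has on \<open>P H\<close> the same frame coefficients as \<open>F\<close>, and each frame inequality
  is inherited with the same bounds. The range is closed since it is the fixed-point set
  of \<open>P\<close>, which is continuous by the theorem of Pythagoras.
\<close>

context hilbert_space
begin

lemma ip_add_right: "ip x (y + z) = ip x y + ip x z"
proof -
  have "ip x (y + z) = conj (ip (y + z) x)"
    by (rule ip_commute)
  also have "\<dots> = conj (ip y x) + conj (ip z x)"
    by (simp only: ip_add_left conj_add)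
  finally show ?thesis
    by (simp only: ip_commute[symmetric])
qed

text \<open>Conjugate symmetry reduces this to \<open>conj 0 = 0\<close>, which additivity of
  \<open>conj\<close> forces through \<open>conj 0 = conj 0 + conj 0\<close>.\<close>

lemma ip_orthogonal_commute: "ip x y = 0 \<Longrightarrow> ip y x = 0"
  using ip_commute[of y x] conj_add[of "0 :: 'k" 0] by simp

lemma pythagoras:
  assumes "ip x y = 0"
  shows "(norm (x + y))\<^sup>2 = (norm x)\<^sup>2 + (norm y)\<^sup>2"
proof -
  have "ip (x + y) (x + y) = ip x x + ip y y"
    using assms ip_orthogonal_commute[OF assms] by (simp add: ip_add_left ip_add_right)
  \<comment> \<open>The values of \<open>ip\<close> lie in \<open>'k\<close>, so the identity is
    first obtained there and carried back to the reals by injectivity of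
    \<open>of_real\<close>.\<close>
  then have "(of_real ((norm (x + y))\<^sup>2) :: 'k) = of_real ((norm x)\<^sup>2 + (norm y)\<^sup>2)"
    by (simp only: ip_self of_real_add)
  then show ?thesis
    by (simp only: of_real_eq_iff)
qed

text \<open>The vector \<open>x\<close> splits into the orthogonal parts \<open>P x\<close> and
  \<open>x - P x\<close>: self-adjointness moves \<open>P\<close> onto \<open>x - P x\<close>, which
  \<open>P\<close> annihilates by idempotence.\<close>

lemma orthogonal_projection_norm_le:
  assumes "orthogonal_projection smul ip P"
  shows "norm (P x) \<le> norm x"
proof -
  interpret P: Vector_Spaces.linear smul smul P
    using assms by (simp add: orthogonal_projection_def)
  have idem: "P (P x) = P x" and adj: "ip (P x) (x - P x) = ip x (P (x - P x))"
    using assms unfolding orthogonal_projection_def by blast+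
  have "P (x - P x) = 0"
    by (simp only: P.diff idem diff_self)
  moreover have "ip x 0 = 0"
    using ip_add_right[of x 0 0] by simp
  ultimately have "ip (P x) (x - P x) = 0"
    by (simp only: adj)
  then have "(norm (P x + (x - P x)))\<^sup>2 = (norm (P x))\<^sup>2 + (norm (x - P x))\<^sup>2"
    by (rule pythagoras)
  moreover have "P x + (x - P x) = x"
    by (simp only: add_diff_eq add_diff_cancel_left')
  ultimately have "(norm x)\<^sup>2 = (norm (P x))\<^sup>2 + (norm (x - P x))\<^sup>2"
    by (simp only:)
  then have "(norm (P x))\<^sup>2 \<le> (norm x)\<^sup>2"
    using zero_le_power2[of "norm (x - P x)"] by linarith
  then show ?thesis
    by (rule power2_le_imp_le) (rule norm_ge_zero)
qed

lemma orthogonal_projection_closed_range: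
  assumes "orthogonal_projection smul ip P"
  shows "closed (range P)"
proof -
  interpret P: Vector_Spaces.linear smul smul P
    using assms by (simp add: orthogonal_projection_def)
  \<comment> \<open>By linearity the norm bound at \<open>x - y\<close> is a Lipschitz estimate with
    constant 1.\<close>
  have "dist (P x) (P y) \<le> 1 * dist x y" for x y
    using orthogonal_projection_norm_le[OF assms, of "x - y"]
    by (simp only: dist_norm P.diff mult_1)
  then have "1-lipschitz_on UNIV P"
    by (intro lipschitz_onI) simp_all
  then have "continuous_on UNIV P"
    by (rule lipschitz_on_continuous_on)
  then have "closed {x. P x = x}"
    by (intro closed_Collect_eq continuous_on_id)
  also have "{x. P x = x} = range P"
  proof (intro set_eqI iffI)
    fix x assume "x \<in> {x. P x = x}"
    then show "x \<in> range P"
      using rangeI[of P x] by simp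
  next
    fix x assume "x \<in> range P"
    then show "x \<in> {x. P x = x}"
      using assms by (auto simp: orthogonal_projection_def)
  qed
  finally show ?thesis .
qed

text \<open>The index set is arbitrary so that the result covers both the full sequence and every
  sequence left after an erasure.\<close>

lemma is_frame_orthogonal_projection:
  assumes P: "orthogonal_projection smul ip P"
    and frame: "is_frame smul ip UNIV I f"
  shows "is_frame smul ip (range P) I (\<lambda>i. P (f i))"
proof -
  interpret P: Vector_Spaces.linear smul smul P
    using P by (simp add: orthogonal_projection_def)
  have coeff: "ip x (P (f i)) = ip x (f i)" if "x \<in> range P" for x i
  proof -
    have "ip x (P (f i)) = ip (P x) (f i)"
      using P by (simp add: orthogonal_projection_def)
    also have "P x = x"
      using P that by (auto simp: orthogonal_projection_def)
    finally show ?thesis .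
  qed
  obtain A B :: real where "A > 0" "B > 0"
    and bounds: "\<forall>x. (\<lambda>i. (norm (ip x (f i)))\<^sup>2) summable_on I \<and>
      A * (norm x)\<^sup>2 \<le> (\<Sum>\<^sub>\<infinity>i\<in>I. (norm (ip x (f i)))\<^sup>2) \<and>
      (\<Sum>\<^sub>\<infinity>i\<in>I. (norm (ip x (f i)))\<^sup>2) \<le> B * (norm x)\<^sup>2"
    using frame unfolding is_frame_def by blast
  have proj_bounds: "\<forall>x\<in>range P. (\<lambda>i. (norm (ip x (P (f i))))\<^sup>2) summable_on I \<and>
      A * (norm x)\<^sup>2 \<le> (\<Sum>\<^sub>\<infinity>i\<in>I. (norm (ip x (P (f i))))\<^sup>2) \<and>
      (\<Sum>\<^sub>\<infinity>i\<in>I. (norm (ip x (P (f i))))\<^sup>2) \<le> B * (norm x)\<^sup>2"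
    \<comment> \<open>The premise of \<open>coeff\<close> concerns \<open>x\<close> alone, so the
      rewriting also reaches the terms under the bound index \<open>i\<close>.\<close>
    by (intro ballI) (simp only: coeff bounds simp_thms)
  show ?thesis
    unfolding is_frame_def
  proof (intro conjI)
    show "subspace (range P)"
      by (intro P.subspace_image subspace_UNIV)
    show "closed (range P)"
      by (rule orthogonal_projection_closed_range[OF P])
    show "countable I"
      using frame by (simp add: is_frame_def)
    show "\<forall>i\<in>I. P (f i) \<in> range P"
      by (intro ballI rangeI)
  qed (rule exI[of _ A], rule exI[of _ B], rule conjI[OF \<open>A > 0\<close> conjI[OF \<open>B > 0\<close> proj_bounds]])
qed

end

theorem proposition4p3:
  fixes smul :: "'k::rc_field \<Rightarrow> 'a::banach \<Rightarrow> 'a"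
    and ip :: "'a \<Rightarrow> 'a \<Rightarrow> 'k"
    and f :: "nat \<Rightarrow> 'a"
    and P :: "'a \<Rightarrow> 'a"
    and m :: nat
  assumes "hilbert_space smul ip"
    and "m \<ge> 1"
    and "erasure_robust_frame smul ip m UNIV f"
    and "orthogonal_projection smul ip P"
  shows "erasure_robust_frame smul ip m (range P) (\<lambda>i. P (f i))"
  \<comment> \<open>The free index set is taken to be \<open>{1..}\<close> and then
    \<open>{1..} - \<Lambda>\<close> for each admissible \<open>\<Lambda>\<close>.\<close>
  using assms(3) hilbert_space.is_frame_orthogonal_projection[OF assms(1,4)]
  unfolding erasure_robust_frame_def by blast

end
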